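(* Consider a sequence of undirected graphs $G=(V,E)$ with $n_v=|V|\to\infty$, all sparse or all dense. For each $G$, let $\{Y_{ij}\}_{\{i,j\}\in V^{(2)}}$ be independent with $Y_{ij}\sim\mathrm{Bernoulli}(\alpha)$ for $\{i,j\}\in E^c$ and $Y_{ij}\sim\mathrm{Bernoulli}(1-\beta)$ for $\{i,j\}\in E$, where $\alpha,\beta\in(0,1)$ may depend on $n_v$. Assume that $\alpha|E^c|=\beta|E|=:\lambda$ and that $\lambda=\Theta(\mu)$, where $\mu=2|E|/n_v$. Let $\hat E=\{\{i,j\}\in V^{(2)}:Y_{ij}=1\}$ and $D_E=|\hat E|-|E|$. Then, both for sparse and for dense graphs $G$, $$d_{KS}\left(D_E,\ \mathrm{Skellam}(\lambda,\lambda)\right)= O\left(n_v^{-1}\right).$$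
   Context: $V^{(2)}$ is the set of unordered pairs of distinct vertices of $V$, and $E^c=V^{(2)}\setminus E$. A (sequence of) graph(s) is called sparse if $|E|=\Theta(n_v\log n_v)$, and dense if $|E|=\Theta(n_v^2)$, with $|E^c|=\Theta(n_v^2)$ in both cases. Thus $\lambda=\Theta(\log n_v)$ in the sparse case and $\lambda=\Theta(n_v)$ in the dense case. Asymptotics are as $n_v\to\infty$. Note $D_E=\sum_{\{i,j\}\in E^c}Y_{ij}-\sum_{\{i,j\}\in E}(1-Y_{ij})$. $\mathrm{Skellam}(\lambda,\lambda)$ is the law of the difference of two independent Poisson random variables with mean $\lambda$. $d_{KS}(X_1,X_2)=\sup_{x\in\mathbb{R}}|\mathbb{P}(X_1\le x)-\mathbb{P}(X_2\le x)|$. *)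

theory Defs
  imports
    "HOL-Probability.Probability"
    "HOL-Library.Landau_Symbols"
    "HOL-Library.Ramsey"
begin

text \<open>
  An undirected simple graph is a finite vertex set \<open>V\<close> together with an edge set
  \<open>E \<subseteq> [V]\<^bsup>2\<^esup>\<close>, where \<open>[V]\<^bsup>2\<^esup>\<close> is the set of two-element subsets of \<open>V\<close>.
\<close>

definition graph :: "'v set \<Rightarrow> 'v set set \<Rightarrow> bool" where
  "graph V E \<longleftrightarrow> finite V \<and> E \<subseteq> [V]\<^bsup>2\<^esup>"

definition non_edges :: "'v set \<Rightarrow> 'v set set \<Rightarrow> 'v set set" where
  "non_edges V E = [V]\<^bsup>2\<^esup> - E"

text \<open>
  Both density regimes are properties of a sequence of graphs, and both include the
  requirement that the number of non-edges is of order \<open>|V|\<^sup>2\<close>.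
\<close>

definition sparse_graphs :: "(nat \<Rightarrow> 'v set) \<Rightarrow> (nat \<Rightarrow> 'v set set) \<Rightarrow> bool" where
  "sparse_graphs V E \<longleftrightarrow>
     (\<lambda>k. real (card (E k))) \<in> \<Theta>(\<lambda>k. real (card (V k)) * ln (real (card (V k)))) \<and>
     (\<lambda>k. real (card (non_edges (V k) (E k)))) \<in> \<Theta>(\<lambda>k. real (card (V k)) ^ 2)"

definition dense_graphs :: "(nat \<Rightarrow> 'v set) \<Rightarrow> (nat \<Rightarrow> 'v set set) \<Rightarrow> bool" where
  "dense_graphs V E \<longleftrightarrow>
     (\<lambda>k. real (card (E k))) \<in> \<Theta>(\<lambda>k. real (card (V k)) ^ 2) \<and>
     (\<lambda>k. real (card (non_edges (V k) (E k)))) \<in> \<Theta>(\<lambda>k. real (card (V k)) ^ 2)"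

definition avg_degree :: "'v set \<Rightarrow> 'v set set \<Rightarrow> real" where
  "avg_degree V E = 2 * real (card E) / real (card V)"

definition has_bernoulli_law :: "'w measure \<Rightarrow> ('w \<Rightarrow> nat) \<Rightarrow> real \<Rightarrow> bool" where
  "has_bernoulli_law M X p \<longleftrightarrow>
     X \<in> M \<rightarrow>\<^sub>M count_space UNIV \<and>
     distr M (count_space UNIV) X = measure_pmf (map_pmf of_bool (bernoulli_pmf p))"

text \<open>
  In the next two definitions \<open>Y e \<omega>\<close> is the observed indicator of the pair \<open>e\<close> at the
  outcome \<open>\<omega>\<close>.
\<close>

definition observed_edges :: "'v set \<Rightarrow> ('v set \<Rightarrow> 'w \<Rightarrow> nat) \<Rightarrow> 'w \<Rightarrow> 'v set set" where
  "observed_edges V Y \<omega> = {e \<in> [V]\<^bsup>2\<^esup>. Y e \<omega> = 1}"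

definition edge_discrepancy ::
    "'v set \<Rightarrow> 'v set set \<Rightarrow> ('v set \<Rightarrow> 'w \<Rightarrow> nat) \<Rightarrow> 'w \<Rightarrow> real" where
  "edge_discrepancy V E Y \<omega> = real (card (observed_edges V Y \<omega>)) - real (card E)"

text \<open>
  The rates are meant to be positive: \<open>poisson_pmf\<close> is unspecified otherwise.
\<close>

definition skellam_pmf :: "real \<Rightarrow> real \<Rightarrow> int pmf" where
  "skellam_pmf a b =
     map_pmf (\<lambda>(m, n). int m - int n) (pair_pmf (poisson_pmf a) (poisson_pmf b))"

definition skellam :: "real \<Rightarrow> real \<Rightarrow> real measure" where
  "skellam a b = distr (measure_pmf (skellam_pmf a b)) borel real_of_int"

text \<open>Kolmogorov--Smirnov distance between two laws on the real line.\<close>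

definition ks_dist :: "real measure \<Rightarrow> real measure \<Rightarrow> real" where
  "ks_dist P Q = (SUP x. \<bar>cdf P x - cdf Q x\<bar>)"

end

theory Submission
  imports Defs
begin

text \<open>
  The discrepancy \<open>D\<close> is the number of spurious edges minus the number of missed edges. These two
  counts are independent and binomial, with parameters \<open>(|N|, \<alpha>)\<close> and \<open>(|E|, \<beta>)\<close>, where \<open>N\<close> is
  the set of non-edges, and both have mean \<open>\<lambda>\<close>. The Skellam law is the same difference formed from
  two independent Poisson variables of mean \<open>\<lambda>\<close>. Once one of the two counts is fixed, the event
  \<open>D \<le> x\<close> is a half line, or the complement of one, for the other. Replacing the counts one after
  the other (\<open>difference_cdf_distance\<close>) therefore reduces the theorem to a comparison of binomial
  and Poisson distribution functions.

  That comparison must not lose a factor of the mean: Le Cam's bound \<open>n p\<^sup>2\<close> is of constant order for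
  dense graphs, because there \<open>\<lambda>\<close> is of order \<open>|V|\<close> and \<open>\<beta>\<close> of order \<open>1/|V|\<close>. The Stein--Chen
  method gives the bound \<open>p\<close> (\<open>binomial_poisson_cdf_distance\<close>). Let \<open>\<lambda> = n p\<close>, let \<open>F\<close> be the Poisson
  distribution function and let \<open>s\<close> solve
  \<open>\<lambda> s(k) - k s(k - 1) = 1{k \<le> m} - F(m)\<close>. For binomial \<open>W\<close> the difference
  \<open>P(W \<le> m) - F(m)\<close> is then \<open>E[\<lambda> s(W) - W s(W - 1)]\<close>, which equals
  \<open>\<lambda> p E[s(W' + 1) - s(W')]\<close> for \<open>W'\<close> binomial with one trial less (\<open>binomial_stein_identity\<close>).
  The increments of \<open>s\<close> are at most \<open>1/\<lambda>\<close> in absolute value (\<open>poisson_stein_increment\<close>), which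
  cancels the factor \<open>\<lambda>\<close>.

  Altogether the Kolmogorov--Smirnov distance is at most \<open>\<alpha> + \<beta>\<close>. Here
  \<open>\<beta> = \<lambda>/|E|\<close> is of order \<open>1/|V|\<close> because \<open>\<lambda>\<close> is of the order of the average degree, and
  \<open>\<alpha> = \<beta>|E|/|N|\<close> is at most a constant times \<open>\<beta>\<close> because \<open>|N|\<close> is of order \<open>|V|\<^sup>2\<close>.
\<close>

section \<open>Stein--Chen comparison of binomial and Poisson laws\<close>

abbreviation binomial_weight :: "real \<Rightarrow> nat \<Rightarrow> nat \<Rightarrow> real" where
  "binomial_weight p n k \<equiv> real (n choose k) * p ^ k * (1 - p) ^ (n - k)"

lemma binomial_weight_Suc_absorb:
  "real (Suc k) * binomial_weight p (Suc n) (Suc k) = real (Suc n) * p * binomial_weight p n k"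
proof -
  have "real (Suc k) * real (Suc n choose Suc k) = real (Suc n) * real (n choose k)"
    using Suc_times_binomial[of k n] by (metis of_nat_mult)
  then show ?thesis by (simp del: binomial_Suc_Suc of_nat_Suc)
qed

lemma binomial_weight_Suc_Suc:
  "binomial_weight p (Suc n) (Suc k) = p * binomial_weight p n k + (1 - p) * binomial_weight p n (Suc k)"
proof (cases "k < n")
  case True
  then have split: "(1 - p) ^ (n - k) = (1 - p) * (1 - p) ^ (n - Suc k)"
    by (metis Suc_diff_Suc power_Suc)
  show ?thesis
    by (simp only: binomial_Suc_Suc of_nat_add diff_Suc_Suc power_Suc split) algebra
next
  case False
  then show ?thesis by (simp add: binomial_eq_0 algebra_simps)
qed

text \<open>
  Conditioning on the last of \<open>n + 1\<close> trials.
\<close>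

lemma binomial_expectation_Suc:
  "(\<Sum>k\<le>Suc n. binomial_weight p (Suc n) k * s k) =
     (1 - p) * (\<Sum>k\<le>n. binomial_weight p n k * s k) + p * (\<Sum>k\<le>n. binomial_weight p n k * s (Suc k))"
proof -
  have "(\<Sum>k\<le>Suc n. binomial_weight p (Suc n) k * s k) =
      (1 - p) * (\<Sum>k\<le>Suc n. binomial_weight p n k * s k) + p * (\<Sum>k\<le>n. binomial_weight p n k * s (Suc k))"
    unfolding sum.atMost_Suc_shift binomial_weight_Suc_Suc
    by (simp add: algebra_simps sum.distrib sum_distrib_left sum_subtractf)
  then show ?thesis by simp
qed

text \<open>
  The size-bias identity \<open>E[W s(W - 1)] = (n + 1) p E[s(W')]\<close>, with \<open>W\<close> counting \<open>n + 1\<close> trials and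
  \<open>W'\<close> the first \<open>n\<close> of them, pairs with \<open>E[s(W)] = (1 - p) E[s(W')] + p E[s(W' + 1)]\<close>; the terms
  \<open>E[s(W')]\<close> combine into an increment and leave a second factor \<open>p\<close>.
\<close>

lemma binomial_stein_identity:
  "(\<Sum>k\<le>Suc n. binomial_weight p (Suc n) k * (real (Suc n) * p * s k - real k * s (k - 1))) =
     real (Suc n) * p\<^sup>2 * (\<Sum>k\<le>n. binomial_weight p n k * (s (Suc k) - s k))"
proof -
  have "(\<Sum>k\<le>Suc n. binomial_weight p (Suc n) k * (real k * s (k - 1))) =
      (\<Sum>k\<le>n. real (Suc k) * binomial_weight p (Suc n) (Suc k) * s k)"
    unfolding sum.atMost_Suc_shift by (simp del: binomial_Suc_Suc of_nat_Suc add: mult_ac)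
  also have "\<dots> = real (Suc n) * p * (\<Sum>k\<le>n. binomial_weight p n k * s k)"
    unfolding binomial_weight_Suc_absorb sum_distrib_left by (simp only: mult.assoc)
  finally have drift: "(\<Sum>k\<le>Suc n. binomial_weight p (Suc n) k * (real k * s (k - 1))) =
      real (Suc n) * p * (\<Sum>k\<le>n. binomial_weight p n k * s k)" .
  have "(\<Sum>k\<le>Suc n. binomial_weight p (Suc n) k * (real (Suc n) * p * s k - real k * s (k - 1))) =
      real (Suc n) * p * (\<Sum>k\<le>Suc n. binomial_weight p (Suc n) k * s k) -
      (\<Sum>k\<le>Suc n. binomial_weight p (Suc n) k * (real k * s (k - 1)))"
    unfolding right_diff_distrib sum_subtractf sum_distrib_left by (simp only: mult_ac)
  also have "\<dots> = real (Suc n) * p\<^sup>2 *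
      ((\<Sum>k\<le>n. binomial_weight p n k * s (Suc k)) - (\<Sum>k\<le>n. binomial_weight p n k * s k))"
    unfolding drift unfolding binomial_expectation_Suc by (simp only: power2_eq_square) algebra
  finally show ?thesis by (simp add: right_diff_distrib sum_subtractf)
qed

lemma poisson_pmf_Suc:
  assumes "l > 0"
  shows "real (Suc k) * pmf (poisson_pmf l) (Suc k) = l * pmf (poisson_pmf l) k"
proof -
  have "real (Suc k) * (l ^ Suc k / fact (Suc k)) = l * (l ^ k / fact k)"
    by (simp del: of_nat_Suc)
  then have "real (Suc k) * (l ^ Suc k / fact (Suc k)) * exp (- l) = l * (l ^ k / fact k) * exp (- l)"
    by (rule arg_cong)
  then show ?thesis using assms by (simp only: pmf_poisson mult.assoc)
qed

text \<open>
  The Poisson recurrence gives \<open>\<lambda> P(X < k) = E[X; X \<le> k]\<close>, and on this event \<open>X\<close> is at most \<open>k\<close>.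
\<close>

lemma poisson_head_bound:
  assumes "l > 0"
  shows "l * measure_pmf.prob (poisson_pmf l) {..<k} \<le> real k * measure_pmf.prob (poisson_pmf l) {..k}"
proof -
  have "l * measure_pmf.prob (poisson_pmf l) {..<k} = (\<Sum>j<k. real (Suc j) * pmf (poisson_pmf l) (Suc j))"
    unfolding poisson_pmf_Suc[OF assms] by (simp add: measure_measure_pmf_finite sum_distrib_left del: pmf_poisson)
  also have "\<dots> = (\<Sum>j\<in>{1..k}. real j * pmf (poisson_pmf l) j)"
    by (rule sum.reindex_bij_witness[of _ "\<lambda>j. j - 1" Suc]) auto
  also have "\<dots> \<le> (\<Sum>j\<in>{1..k}. real k * pmf (poisson_pmf l) j)"
    by (intro sum_mono mult_right_mono) auto
  also have "\<dots> \<le> (\<Sum>j\<le>k. real k * pmf (poisson_pmf l) j)"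
    by (intro sum_mono2) (auto simp del: pmf_poisson)
  finally show ?thesis
    by (simp add: measure_measure_pmf_finite sum_distrib_left del: pmf_poisson)
qed

lemma prob_lessThan_tendsto_1:
  fixes D :: "nat pmf"
  shows "(\<lambda>n. measure_pmf.prob D {..<n}) \<longlonglongrightarrow> 1"
proof -
  have "(\<lambda>n. measure_pmf.prob D {..<n}) \<longlonglongrightarrow> measure_pmf.prob D (\<Union>n. {..<n})"
    by (rule measure_pmf.finite_Lim_measure_incseq) (auto simp: incseq_def)
  also have "(\<Union>n::nat. {..<n}) = UNIV" by auto
  finally show ?thesis by simp
qed

text \<open>
  The mirror image of the previous bound: \<open>\<lambda> P(X \<ge> k) = E[X; X > k]\<close>, and there \<open>X\<close> is at least
  \<open>k\<close>. Truncating the tail at \<open>n\<close> keeps every sum finite until the final limit.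
\<close>

lemma poisson_tail_bound:
  assumes "l > 0"
  shows "real k * (1 - measure_pmf.prob (poisson_pmf l) {..k}) \<le> l * (1 - measure_pmf.prob (poisson_pmf l) {..<k})"
proof (rule LIMSEQ_le_const2)
  let ?F = "\<lambda>n. measure_pmf.prob (poisson_pmf l) {..<n}"
  show "(\<lambda>n. real k * (?F (Suc n) - measure_pmf.prob (poisson_pmf l) {..k}))
      \<longlonglongrightarrow> real k * (1 - measure_pmf.prob (poisson_pmf l) {..k})"
    by (intro tendsto_intros LIMSEQ_Suc prob_lessThan_tendsto_1)
  show "\<exists>N. \<forall>n\<ge>N. real k * (?F (Suc n) - measure_pmf.prob (poisson_pmf l) {..k}) \<le> l * (1 - ?F k)"
  proof (intro exI allI impI)
    fix n assume n: "n \<ge> k"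
    have "?F (Suc n) - measure_pmf.prob (poisson_pmf l) {..k} = sum (pmf (poisson_pmf l)) ({..<Suc n} - {..k})"
      using n by (subst sum_diff) (auto simp: measure_measure_pmf_finite simp del: pmf_poisson)
    also have "{..<Suc n} - {..k} = {Suc k..<Suc n}" by auto
    also have "sum (pmf (poisson_pmf l)) {Suc k..<Suc n} = (\<Sum>j\<in>{k..<n}. pmf (poisson_pmf l) (Suc j))"
      by (rule sum.shift_bounds_Suc_ivl)
    finally have "real k * (?F (Suc n) - measure_pmf.prob (poisson_pmf l) {..k}) =
        (\<Sum>j\<in>{k..<n}. real k * pmf (poisson_pmf l) (Suc j))"
      by (simp add: sum_distrib_left del: pmf_poisson)
    also have "\<dots> \<le> (\<Sum>j\<in>{k..<n}. real (Suc j) * pmf (poisson_pmf l) (Suc j))"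
      by (intro sum_mono mult_right_mono) auto
    also have "\<dots> = l * measure_pmf.prob (poisson_pmf l) {k..<n}"
      unfolding poisson_pmf_Suc[OF assms]
      by (simp add: sum_distrib_left measure_measure_pmf_finite del: pmf_poisson)
    also have "\<dots> \<le> l * measure_pmf.prob (poisson_pmf l) (UNIV - {..<k})"
      using assms by (intro mult_left_mono measure_pmf.finite_measure_mono) auto
    also have "\<dots> = l * (1 - ?F k)"
      using measure_pmf.prob_compl[of "{..<k}" "poisson_pmf l"] by simp
    finally show "real k * (?F (Suc n) - measure_pmf.prob (poisson_pmf l) {..k}) \<le> l * (1 - ?F k)" .
  qed
qed

text \<open>
  The solution of the Stein equation for the half line \<open>{..m}\<close>, obtained by multiplying the equation
  by the Poisson weight of \<open>k\<close> and summing it up to \<open>k\<close>. In the common notation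
  \<open>\<lambda> g(k + 1) - k g(k)\<close> for the left-hand side it is \<open>s(k) = g(k + 1)\<close>; with this shift the equation
  determines \<open>s\<close> from \<open>k = 0\<close> on.
\<close>

definition poisson_stein :: "real \<Rightarrow> nat \<Rightarrow> nat \<Rightarrow> real" where
  "poisson_stein l m k =
     measure_pmf.prob (poisson_pmf l) {..min k m} * (1 - measure_pmf.prob (poisson_pmf l) {..max k m})
       / (l * pmf (poisson_pmf l) k)"

lemma poisson_pmf_pos: "l > 0 \<Longrightarrow> pmf (poisson_pmf l) k > 0"
  by simp

lemma prob_atMost_eq_lessThan: 
  fixes D :: "nat pmf"
  shows "measure_pmf.prob D {..k} = measure_pmf.prob D {..<k} + pmf D k"
  by (simp add: measure_measure_pmf_finite lessThan_Suc_atMost[symmetric])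

lemma poisson_stein_equation:
  assumes l: "l > 0"
  shows "l * poisson_stein l m k - real k * poisson_stein l m (k - 1) =
           of_bool (k \<le> m) - measure_pmf.prob (poisson_pmf l) {..m}"
proof (cases k)
  case 0
  have "measure_pmf.prob (poisson_pmf l) {..0} = pmf (poisson_pmf l) 0"
    by (simp add: measure_pmf_single del: pmf_poisson)
  then show ?thesis
    using 0 l poisson_pmf_pos[OF l, of 0] by (simp add: poisson_stein_def del: pmf_poisson)
next
  case (Suc j)
  let ?F = "\<lambda>k. measure_pmf.prob (poisson_pmf l) {..k}"
  let ?w = "pmf (poisson_pmf l) k"
  have w: "?w > 0" by (rule poisson_pmf_pos[OF l])
  have pj: "l * pmf (poisson_pmf l) j = real k * ?w"
    using poisson_pmf_Suc[OF l, of j] Suc by metis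
  have F: "?F k = ?F j + ?w"
    unfolding prob_atMost_eq_lessThan[of _ k] by (simp add: Suc lessThan_Suc_atMost del: pmf_poisson)
  have A: "l * poisson_stein l m k = ?F (min k m) * (1 - ?F (max k m)) / ?w"
    using l by (simp add: poisson_stein_def del: pmf_poisson)
  have B: "real k * poisson_stein l m (k - 1) = ?F (min j m) * (1 - ?F (max j m)) / ?w"
    using Suc unfolding poisson_stein_def diff_Suc_1 Suc pj[unfolded Suc] 
    by (simp del: pmf_poisson of_nat_Suc)
  show ?thesis
  proof (cases "k \<le> m")
    case True
    with Suc have "min k m = k" "max k m = m" "min j m = j" "max j m = m" by auto
    then show ?thesis unfolding A B F using True w by (simp add: field_simps F del: pmf_poisson)
  next
    case False
    with Suc have "min k m = m" "max k m = k" "min j m = m" "max j m = j" by auto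
    then show ?thesis unfolding A B F using False w by (simp add: field_simps F del: pmf_poisson)
  qed
qed

text \<open>
  The solution increases up to \<open>m\<close> and decreases from there on. On each side, monotonicity of the
  distribution function reduces the bound on the size of the step from \<open>k\<close> to \<open>k + 1\<close> to the worst
  choice of \<open>m\<close>, which is \<open>k + 1\<close> on the increasing side and \<open>k\<close> on the decreasing one. What is left is an inequality between the head \<open>a\<close>, the atom \<open>w\<close> and the
  tail \<open>b\<close> of the Poisson law at \<open>k + 1\<close>; it follows from the head and tail bounds, whose roles
  depend on which side of the mean \<open>k + 1\<close> lies.
\<close>

lemma poisson_stein_increment:
  assumes l: "l > 0"
  shows "\<bar>poisson_stein l m (Suc k) - poisson_stein l m k\<bar> \<le> 1 / l"
proof -
  let ?F = "\<lambda>k. measure_pmf.prob (poisson_pmf l) {..k}"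
  define K where "K = real (Suc k)"
  define a where "a = ?F k"
  define w where "w = pmf (poisson_pmf l) (Suc k)"
  define b where "b = 1 - a - w"
  have FS: "?F (Suc k) = a + w"
    unfolding prob_atMost_eq_lessThan[of _ "Suc k"] a_def w_def by (simp add: lessThan_Suc_atMost)
  have w: "w > 0" unfolding w_def by (rule poisson_pmf_pos[OF l])
  have K: "K > 0" by (simp add: K_def)
  have a: "a \<ge> 0" by (simp add: a_def)
  have "?F (Suc k) \<le> 1" by simp
  then have b: "b \<ge> 0" unfolding FS b_def by simp
  have pk: "l * pmf (poisson_pmf l) k = K * w"
    using poisson_pmf_Suc[OF l, of k] unfolding K_def w_def by metis
  have L: "l * a \<le> K * (a + w)"
    using poisson_head_bound[OF l, of "Suc k"] unfolding FS lessThan_Suc_atMost a_def K_def .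
  have U: "K * b \<le> l * (b + w)"
    using poisson_tail_bound[OF l, of "Suc k"] unfolding FS lessThan_Suc_atMost
    by (simp add: a_def K_def b_def algebra_simps)
  have sum1: "a + w + b = 1" by (simp add: b_def)
  \<comment> \<open>The case \<open>m = k + 1\<close>, with the factor \<open>1 / (\<lambda> K w)\<close> cleared.\<close>
  have incr_step: "b * (K * (a + w) - l * a) \<le> K * w"
  proof (cases "K \<le> l")
    case True
    then have "0 \<le> b * (a * (l - K))" using a b by simp
    then have "b * (K * (a + w) - l * a) \<le> b * (K * w)" by (simp add: algebra_simps)
    also have "\<dots> \<le> 1 * (K * w)" using K w a b sum1 by (intro mult_right_mono) auto
    finally show ?thesis by simp
  next
    case False
    have "(K - l) * b * a \<le> l * w * a" using U a by (intro mult_right_mono) (auto simp: algebra_simps)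
    also have "\<dots> \<le> K * w * a" using False w a by (intro mult_right_mono) auto
    finally have "b * (K * (a + w) - l * a) \<le> K * w * (a + b)" by (simp add: algebra_simps)
    also have "\<dots> \<le> K * w * 1" using K w sum1 by (intro mult_left_mono) auto
    finally show ?thesis by simp
  qed
  \<comment> \<open>The case \<open>m = k\<close>, likewise.\<close>
  have decr_step: "a * (l * (b + w) - K * b) \<le> K * w"
  proof (cases "l \<le> K")
    case True
    then have "0 \<le> a * (b * (K - l))" using a b by simp
    then have "a * (l * (b + w) - K * b) \<le> a * (l * w)" by (simp add: algebra_simps)
    also have "\<dots> \<le> 1 * (K * w)" using True l K w a b sum1 by (intro mult_mono) auto
    finally show ?thesis by simp
  next
    case False
    have "a * (l - K) * b \<le> K * w * b" using L b by (intro mult_right_mono) (auto simp: algebra_simps)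
    moreover have "l * a * w \<le> K * (a + w) * w" using L w by (intro mult_right_mono) auto
    ultimately have "a * (l * (b + w) - K * b) \<le> K * w * (a + w + b)" by (simp add: algebra_simps)
    then show ?thesis by (simp add: sum1)
  qed
  have unit: "\<bar>q / l\<bar> \<le> 1 / l" if "0 \<le> q" "q \<le> 1" for q
    using that l by (simp add: divide_right_mono)
  have mono: "?F i \<le> ?F j" if "i \<le> j" for i j
    using that by (intro measure_pmf.finite_measure_mono) auto
  show ?thesis
  proof (cases "Suc k \<le> m")
    case True
    define c where "c = 1 - ?F m"
    have c: "0 \<le> c" "c \<le> b"
      using mono[OF True] unfolding FS by (auto simp: c_def b_def)
    have eq: "poisson_stein l m (Suc k) - poisson_stein l m k = c * (K * (a + w) - l * a) / (K * w) / l"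
      unfolding poisson_stein_def pk using True FS w K l
      by (simp add: c_def[symmetric] a_def[symmetric] w_def[symmetric] field_simps del: pmf_poisson)
    have "c * (K * (a + w) - l * a) \<le> b * (K * (a + w) - l * a)"
      using c L by (intro mult_right_mono) auto
    then have "c * (K * (a + w) - l * a) / (K * w) \<le> 1"
      using incr_step K w by (simp add: divide_simps)
    moreover have "0 \<le> c * (K * (a + w) - l * a) / (K * w)"
      using c L K w by (intro divide_nonneg_pos mult_nonneg_nonneg) auto
    ultimately show ?thesis unfolding eq by (intro unit)
  next
    case False
    define c where "c = ?F m"
    have minmax: "min k m = m" "max k m = k" "min (Suc k) m = m" "max (Suc k) m = Suc k"
      using False by auto
    have c: "0 \<le> c" "c \<le> a"
      using mono[of m k] False by (auto simp: c_def a_def)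
    have eq: "poisson_stein l m k - poisson_stein l m (Suc k) = c * (l * (b + w) - K * b) / (K * w) / l"
      unfolding poisson_stein_def pk minmax using FS w K l
      by (simp add: c_def[symmetric] a_def[symmetric] w_def[symmetric] b_def field_simps del: pmf_poisson)
    have "c * (l * (b + w) - K * b) \<le> a * (l * (b + w) - K * b)"
      using c U by (intro mult_right_mono) auto
    then have "c * (l * (b + w) - K * b) / (K * w) \<le> 1"
      using decr_step K w by (simp add: divide_simps)
    moreover have "0 \<le> c * (l * (b + w) - K * b) / (K * w)"
      using c U K w by (intro divide_nonneg_pos mult_nonneg_nonneg) auto
    ultimately show ?thesis unfolding abs_minus_commute[of "poisson_stein l m (Suc k)"] eq
      by (intro unit)
  qed
qed

lemma sum_binomial_weight:
  "(\<Sum>k\<le>n. binomial_weight p n k) = 1"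
  using binomial_ring[of p "1 - p" n] by simp

text \<open>
  The expectation of the Stein increments carries the factor \<open>n p \<cdot> p\<close>, and their size \<open>1 / (n p)\<close>
  cancels the mean, so the bound does not grow with the number of trials.
\<close>

lemma binomial_poisson_cdf_distance:
  assumes p: "0 < p" "p < 1" and n: "n > 0"
  shows "\<bar>measure_pmf.prob (binomial_pmf n p) {..m} - measure_pmf.prob (poisson_pmf (real n * p)) {..m}\<bar> \<le> p"
proof -
  obtain N where N: "n = Suc N" using n by (cases n) auto
  define l where "l = real n * p"
  have l: "l > 0" using p n by (simp add: l_def)
  let ?F = "measure_pmf.prob (poisson_pmf l) {..m}"
  have pm: "pmf (binomial_pmf j p) k = binomial_weight p j k" for j k
    using p by simp
  have "measure_pmf.prob (binomial_pmf n p) {..m} = measure_pmf.prob (binomial_pmf n p) ({..m} \<inter> {..n})"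
    using p measure_Int_set_pmf[of "binomial_pmf n p" "{..m}"] by simp
  also have "\<dots> = (\<Sum>k\<in>{..m} \<inter> {..n}. binomial_weight p n k)"
    by (simp add: measure_measure_pmf_finite pm del: pmf_binomial)
  also have "\<dots> = (\<Sum>k\<le>n. binomial_weight p n k * of_bool (k \<le> m))"
    by (rule sum.mono_neutral_cong_left) auto
  finally have "measure_pmf.prob (binomial_pmf n p) {..m} - ?F =
      (\<Sum>k\<le>n. binomial_weight p n k * of_bool (k \<le> m)) - (\<Sum>k\<le>n. binomial_weight p n k) * ?F"
    by (simp only: sum_binomial_weight mult_1)
  also have "\<dots> = (\<Sum>k\<le>n. binomial_weight p n k * (of_bool (k \<le> m) - ?F))"
    unfolding right_diff_distrib sum_subtractf sum_distrib_right ..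
  also have "\<dots> = l * p * (\<Sum>k\<le>N. binomial_weight p N k * (poisson_stein l m (Suc k) - poisson_stein l m k))"
    unfolding poisson_stein_equation[OF l, symmetric]
    using binomial_stein_identity[where p = p and n = N and s = "poisson_stein l m"]
    unfolding l_def N by (simp only: power2_eq_square mult.assoc)
  finally have "\<bar>measure_pmf.prob (binomial_pmf n p) {..m} - ?F\<bar> =
      l * p * \<bar>\<Sum>k\<le>N. binomial_weight p N k * (poisson_stein l m (Suc k) - poisson_stein l m k)\<bar>"
    using l p by (simp add: abs_mult)
  also have "\<dots> \<le> l * p * (\<Sum>k\<le>N. binomial_weight p N k * (1 / l))"
  proof (intro mult_left_mono sum_abs[THEN order_trans] sum_mono)
    fix k
    show "\<bar>binomial_weight p N k * (poisson_stein l m (Suc k) - poisson_stein l m k)\<bar> \<le> binomial_weight p N k * (1 / l)"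
      using p poisson_stein_increment[OF l, of m k] unfolding abs_mult
      by (intro mult_mono) auto
  qed (use l p in auto)
  also have "\<dots> = p"
    unfolding sum_distrib_right[symmetric] sum_binomial_weight using l by simp
  finally show ?thesis unfolding l_def .
qed

section \<open>Differences of independent counts\<close>

lemma prob_pair_pmf_fst_conditioning:
  "measure_pmf.prob (pair_pmf P Q) S = measure_pmf.expectation P (\<lambda>i. measure_pmf.prob Q {j. (i, j) \<in> S})"
proof -
  have "emeasure (measure_pmf (pair_pmf P Q)) S = (\<integral>\<^sup>+i. \<integral>\<^sup>+j. indicator S (i, j) \<partial>Q \<partial>P)"
    by (subst nn_integral_pair_pmf'[symmetric]) simp
  also have "\<dots> = (\<integral>\<^sup>+i. ennreal (measure_pmf.prob Q {j. (i, j) \<in> S}) \<partial>P)"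
  proof (intro nn_integral_cong)
    fix i
    have "(\<integral>\<^sup>+j. indicator S (i, j) \<partial>Q) = (\<integral>\<^sup>+j. indicator {j. (i, j) \<in> S} j \<partial>Q)"
      by (intro nn_integral_cong) (auto simp: indicator_def)
    then show "(\<integral>\<^sup>+j. indicator S (i, j) \<partial>Q) = ennreal (measure_pmf.prob Q {j. (i, j) \<in> S})"
      by (simp add: measure_pmf.emeasure_eq_measure)
  qed
  also have "\<dots> = ennreal (measure_pmf.expectation P (\<lambda>i. measure_pmf.prob Q {j. (i, j) \<in> S}))"
    by (intro nn_integral_eq_integral measure_pmf.integrable_const_bound[where B=1]) auto
  finally show ?thesis
    by (simp add: measure_pmf.emeasure_eq_measure ennreal_inj integral_nonneg_AE)
qed

lemma prob_pair_pmf_replace_snd: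
  assumes "\<And>i. \<bar>measure_pmf.prob Q {j. (i, j) \<in> S} - measure_pmf.prob Q' {j. (i, j) \<in> S}\<bar> \<le> c"
  shows "\<bar>measure_pmf.prob (pair_pmf P Q) S - measure_pmf.prob (pair_pmf P Q') S\<bar> \<le> c"
proof -
  have int: "integrable P (\<lambda>i. measure_pmf.prob R {j. (i, j) \<in> S})" for R
    by (intro measure_pmf.integrable_const_bound[where B=1]) auto
  have "\<bar>measure_pmf.prob (pair_pmf P Q) S - measure_pmf.prob (pair_pmf P Q') S\<bar> =
      \<bar>measure_pmf.expectation P (\<lambda>i. measure_pmf.prob Q {j. (i, j) \<in> S} - measure_pmf.prob Q' {j. (i, j) \<in> S})\<bar>"
    by (simp add: prob_pair_pmf_fst_conditioning int)
  also have "\<dots> \<le> measure_pmf.expectation P (\<lambda>i. \<bar>measure_pmf.prob Q {j. (i, j) \<in> S} - measure_pmf.prob Q' {j. (i, j) \<in> S}\<bar>)"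
    by (rule integral_abs_bound)
  also have "\<dots> \<le> measure_pmf.expectation P (\<lambda>i. c)"
    using assms int by (intro integral_mono integrable_abs Bochner_Integration.integrable_diff) auto
  finally show ?thesis by simp
qed

lemma prob_pair_pmf_swap:
  "measure_pmf.prob (pair_pmf P Q) S = measure_pmf.prob (pair_pmf Q P) {(j, i). (i, j) \<in> S}"
  by (subst pair_commute_pmf) (auto intro!: arg_cong[where f="measure_pmf.prob (pair_pmf Q P)"])

text \<open>
  A hybrid argument through the pair \<open>(P, Q')\<close>. The sections of \<open>{i - j \<le> x}\<close> are initial segments in
  \<open>i\<close> and complements of initial segments in \<open>j\<close>, so closeness of distribution functions suffices.
\<close>

lemma difference_cdf_distance:
  fixes P P' Q Q' :: "nat pmf" and x :: real
  assumes P: "\<And>m. \<bar>measure_pmf.prob P {..m} - measure_pmf.prob P' {..m}\<bar> \<le> a"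
    and Q: "\<And>m. \<bar>measure_pmf.prob Q {..m} - measure_pmf.prob Q' {..m}\<bar> \<le> b"
  defines "S \<equiv> {(i, j). real_of_int (int i - int j) \<le> x}"
  shows "\<bar>measure_pmf.prob (pair_pmf P Q) S - measure_pmf.prob (pair_pmf P' Q') S\<bar> \<le> a + b"
proof -
  have a: "a \<ge> 0" using P[of 0] by linarith
  have b: "b \<ge> 0" using Q[of 0] by linarith
  have S_iff: "(i, j) \<in> S \<longleftrightarrow> int i \<le> int j + \<lfloor>x\<rfloor>" for i j
    unfolding S_def by (simp add: le_floor_iff[symmetric] algebra_simps) linarith
  have "\<bar>measure_pmf.prob (pair_pmf P Q) S - measure_pmf.prob (pair_pmf P Q') S\<bar> \<le> b"
  proof (rule prob_pair_pmf_replace_snd)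
    fix i
    show "\<bar>measure_pmf.prob Q {j. (i, j) \<in> S} - measure_pmf.prob Q' {j. (i, j) \<in> S}\<bar> \<le> b"
    proof (cases "int i - \<lfloor>x\<rfloor> \<le> 0")
      case True
      then have "{j. (i, j) \<in> S} = UNIV" by (auto simp: S_iff)
      then show ?thesis using b by simp
    next
      case False
      define m where "m = nat (int i - \<lfloor>x\<rfloor> - 1)"
      have "{j. (i, j) \<in> S} = UNIV - {..m}" using False by (auto simp: S_iff m_def)
      then have "measure_pmf.prob R {j. (i, j) \<in> S} = 1 - measure_pmf.prob R {..m}" for R
        using measure_pmf.prob_compl[of "{..m}" R] by simp
      then show ?thesis using Q[of m] by simp
    qed
  qed
  moreover have "\<bar>measure_pmf.prob (pair_pmf P Q') S - measure_pmf.prob (pair_pmf P' Q') S\<bar> \<le> a"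
    unfolding prob_pair_pmf_swap[of _ Q']
  proof (rule prob_pair_pmf_replace_snd)
    fix j
    have "{i. (j, i) \<in> {(j, i). (i, j) \<in> S}} = (if int j + \<lfloor>x\<rfloor> < 0 then {} else {..nat (int j + \<lfloor>x\<rfloor>)})"
      by (auto simp: S_iff)
    then show "\<bar>measure_pmf.prob P {i. (j, i) \<in> {(j, i). (i, j) \<in> S}} -
        measure_pmf.prob P' {i. (j, i) \<in> {(j, i). (i, j) \<in> S}}\<bar> \<le> a"
      using P a by simp
  qed
  ultimately show ?thesis by linarith
qed

section \<open>The law of the edge discrepancy\<close>

lemma (in prob_space) prob_finite_range:
  assumes "finite R" "\<And>\<omega>. \<omega> \<in> space M \<Longrightarrow> X \<omega> \<in> R"
    and "\<And>S. S \<in> R \<Longrightarrow> {\<omega> \<in> space M. X \<omega> = S} \<in> events"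
  shows "prob {\<omega> \<in> space M. Q (X \<omega>)} = (\<Sum>S\<in>{S \<in> R. Q S}. prob {\<omega> \<in> space M. X \<omega> = S})"
proof -
  have "{\<omega> \<in> space M. Q (X \<omega>)} = (\<Union>S\<in>{S \<in> R. Q S}. {\<omega> \<in> space M. X \<omega> = S})"
    using assms(2) by auto
  also have "prob \<dots> = (\<Sum>S\<in>{S \<in> R. Q S}. prob {\<omega> \<in> space M. X \<omega> = S})"
    using assms by (intro finite_measure_finite_Union) (auto simp: disjoint_family_on_def)
  finally show ?thesis .
qed

lemma (in prob_space) bernoulli_law_prob:
  assumes "has_bernoulli_law M X p" "0 \<le> p" "p \<le> 1"
  shows "prob (X -` {1} \<inter> space M) = p" "prob (X -` (- {1}) \<inter> space M) = 1 - p"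
proof -
  have X: "X \<in> M \<rightarrow>\<^sub>M count_space UNIV"
    and D: "distr M (count_space UNIV) X = measure_pmf (map_pmf of_bool (bernoulli_pmf p))"
    using assms by (auto simp: has_bernoulli_law_def)
  have "prob (X -` {1} \<inter> space M) = measure (distr M (count_space UNIV) X) {1}"
    using X by (simp add: measure_distr)
  also have "\<dots> = measure_pmf.prob (bernoulli_pmf p) {True}"
    unfolding D by (auto intro!: arg_cong[where f = "measure_pmf.prob (bernoulli_pmf p)"] simp: of_bool_def split: if_splits)
  also have "\<dots> = p"
    using assms by (simp add: measure_pmf_single)
  finally show "prob (X -` {1} \<inter> space M) = p" .
  moreover have "X -` (- {1}) \<inter> space M = space M - (X -` {1} \<inter> space M)" by auto
  moreover have "X -` {1} \<inter> space M \<in> events" using X by (rule measurable_sets) simp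
  ultimately show "prob (X -` (- {1}) \<inter> space M) = 1 - p"
    by (simp add: prob_compl)
qed

text \<open>
  Transfers questions about the random set of successes from an arbitrary probability space to a
  finite product of Bernoulli distributions. The set of successes, unlike the vector of the \<open>Y e\<close>,
  takes only finitely many values: off a null set \<open>Y e\<close> may be any natural number.
\<close>

lemma (in prob_space) success_set_law:
  assumes A: "finite A" "A \<noteq> {}"
    and indep: "indep_vars (\<lambda>_. count_space UNIV) Y A"
    and law: "\<And>e. e \<in> A \<Longrightarrow> has_bernoulli_law M (Y e) (p e)"
    and p: "\<And>e. e \<in> A \<Longrightarrow> 0 \<le> p e \<and> p e \<le> 1"
  shows "{\<omega> \<in> space M. Q {e \<in> A. Y e \<omega> = 1}} \<in> events"
    and "prob {\<omega> \<in> space M. Q {e \<in> A. Y e \<omega> = 1}} =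
           measure_pmf.prob (Pi_pmf A False (\<lambda>e. bernoulli_pmf (p e))) {f. Q {e \<in> A. f e}}"
proof -
  let ?P = "Pi_pmf A False (\<lambda>e. bernoulli_pmf (p e))"
  have Y: "Y e \<in> M \<rightarrow>\<^sub>M count_space UNIV" if "e \<in> A" for e
    using law[OF that] by (simp add: has_bernoulli_law_def)
  define B :: "'b set \<Rightarrow> 'b \<Rightarrow> nat set" where "B = (\<lambda>S e. if e \<in> S then {1} else - {1})"
  have fibre: "{\<omega> \<in> space M. {e \<in> A. Y e \<omega> = 1} = S} = (\<Inter>e\<in>A. Y e -` B S e \<inter> space M)" if "S \<subseteq> A" for S
    using that A by (auto simp: B_def split: if_splits)
  have fibre_event: "{\<omega> \<in> space M. {e \<in> A. Y e \<omega> = 1} = S} \<in> events" if "S \<subseteq> A" for S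
    unfolding fibre[OF that] using A Y by (intro sets.finite_INT measurable_sets[OF Y]) auto
  have "{\<omega> \<in> space M. Q {e \<in> A. Y e \<omega> = 1}} =
      (\<Union>S\<in>{S \<in> Pow A. Q S}. {\<omega> \<in> space M. {e \<in> A. Y e \<omega> = 1} = S})"
    by auto
  also have "\<dots> \<in> events"
    using A fibre_event by (intro sets.finite_UN) auto
  finally show "{\<omega> \<in> space M. Q {e \<in> A. Y e \<omega> = 1}} \<in> events" .
  have "prob {\<omega> \<in> space M. Q {e \<in> A. Y e \<omega> = 1}} =
      (\<Sum>S\<in>{S \<in> Pow A. Q S}. prob {\<omega> \<in> space M. {e \<in> A. Y e \<omega> = 1} = S})"
    using A fibre_event by (intro prob_finite_range) auto
  also have "\<dots> = (\<Sum>S\<in>{S \<in> Pow A. Q S}. measure_pmf.prob ?P {f. {e \<in> A. f e} = S})"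
  proof (intro sum.cong refl)
    fix S assume "S \<in> {S \<in> Pow A. Q S}"
    then have S: "S \<subseteq> A" by simp
    have "prob {\<omega> \<in> space M. {e \<in> A. Y e \<omega> = 1} = S} = (\<Prod>e\<in>A. prob (Y e -` B S e \<inter> space M))"
      unfolding fibre[OF S] using A by (intro indep_varsD_finite[OF indep]) auto
    also have "\<dots> = (\<Prod>e\<in>A. measure_pmf.prob (bernoulli_pmf (p e)) {e \<in> S})"
      using bernoulli_law_prob[OF law] p by (intro prod.cong) (auto simp: B_def measure_pmf_single)
    also have "\<dots> = measure_pmf.prob ?P (Pi A (\<lambda>e. {e \<in> S}))"
      using A by (simp add: measure_Pi_pmf_Pi)
    also have "Pi A (\<lambda>e. {e \<in> S}) = {f. {e \<in> A. f e} = S}"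
      using S by (auto simp: Pi_def)
    finally show "prob {\<omega> \<in> space M. {e \<in> A. Y e \<omega> = 1} = S} = measure_pmf.prob ?P {f. {e \<in> A. f e} = S}" .
  qed
  also have "\<dots> = measure_pmf.prob ?P {f. Q {e \<in> A. f e}}"
    using A measure_pmf.prob_finite_range[of "Pow A" ?P "\<lambda>f. {e \<in> A. f e}" Q] by auto
  finally show "prob {\<omega> \<in> space M. Q {e \<in> A. Y e \<omega> = 1}} = measure_pmf.prob ?P {f. Q {e \<in> A. f e}}" .
qed

lemma failure_count_law:
  assumes "finite A" "0 \<le> b" "b \<le> 1"
  shows "map_pmf (\<lambda>f. card {e \<in> A. \<not> f e}) (Pi_pmf A False (\<lambda>_. bernoulli_pmf (1 - b))) = binomial_pmf (card A) b"
proof -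
  have flip: "bernoulli_pmf b = map_pmf Not (bernoulli_pmf (1 - b))"
  proof (rule pmf_eqI)
    fix y
    have "pmf (map_pmf Not (bernoulli_pmf (1 - b))) y = pmf (bernoulli_pmf (1 - b)) (\<not> y)"
      using pmf_map_inj'[of Not "bernoulli_pmf (1 - b)" "\<not> y"] by (simp add: inj_def)
    then show "pmf (bernoulli_pmf b) y = pmf (map_pmf Not (bernoulli_pmf (1 - b))) y"
      using assms by (cases y) auto
  qed
  have "binomial_pmf (card A) b = map_pmf (\<lambda>f. card {e \<in> A. f e}) (Pi_pmf A True (\<lambda>_. bernoulli_pmf b))"
    using assms by (intro binomial_pmf_altdef') auto
  also have "Pi_pmf A True (\<lambda>_. bernoulli_pmf b) =
      map_pmf (\<lambda>h. Not \<circ> h) (Pi_pmf A False (\<lambda>_. bernoulli_pmf (1 - b)))"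
    unfolding flip using assms by (intro Pi_pmf_map) auto
  finally show ?thesis by (simp add: map_pmf_comp)
qed

text \<open>
  The successes on \<open>E\<close> minus \<open>|E|\<close> are minus the failures on \<open>E\<close>, so successes on \<open>N\<close> and
  failures on \<open>E\<close> are the two independent binomial counts.
\<close>

lemma success_count_minus_card_law:
  assumes E: "finite E" "finite N" "N \<inter> E = {}"
    and a: "0 \<le> a" "a \<le> 1" and b: "0 \<le> b" "b \<le> 1"
  shows "map_pmf (\<lambda>f. int (card {e \<in> N \<union> E. f e}) - int (card E))
           (Pi_pmf (N \<union> E) False (\<lambda>e. bernoulli_pmf (if e \<in> E then 1 - b else a))) =
         map_pmf (\<lambda>(i, j). int i - int j) (pair_pmf (binomial_pmf (card N) a) (binomial_pmf (card E) b))"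
proof -
  let ?p = "\<lambda>e. bernoulli_pmf (if e \<in> E then 1 - b else a)"
  have N: "Pi_pmf N False ?p = Pi_pmf N False (\<lambda>_. bernoulli_pmf a)"
    using E by (intro Pi_pmf_cong) auto
  have E': "Pi_pmf E False ?p = Pi_pmf E False (\<lambda>_. bernoulli_pmf (1 - b))"
    by (intro Pi_pmf_cong) auto
  have count: "int (card {e \<in> N \<union> E. if e \<in> N then f e else g e}) - int (card E) =
      int (card {e \<in> N. f e}) - int (card {e \<in> E. \<not> g e})" for f g
  proof -
    have "{e \<in> N \<union> E. if e \<in> N then f e else g e} = {e \<in> N. f e} \<union> {e \<in> E. g e}"
      using E by auto
    moreover have "card ({e \<in> N. f e} \<union> {e \<in> E. g e}) = card {e \<in> N. f e} + card {e \<in> E. g e}"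
      using E by (intro card_Un_disjoint) auto
    moreover have "card ({e \<in> E. g e} \<union> {e \<in> E. \<not> g e}) = card {e \<in> E. g e} + card {e \<in> E. \<not> g e}"
      using E by (intro card_Un_disjoint) auto
    moreover have "{e \<in> E. g e} \<union> {e \<in> E. \<not> g e} = E" by auto
    ultimately show ?thesis by simp
  qed
  have bN: "binomial_pmf (card N) a = map_pmf (\<lambda>f. card {e \<in> N. f e}) (Pi_pmf N False (\<lambda>_. bernoulli_pmf a))"
    using E a by (intro binomial_pmf_altdef') auto
  show ?thesis
    unfolding bN failure_count_law[OF E(1) b, symmetric] map_pair[symmetric]
    by (subst Pi_pmf_union[OF E(2,1,3)]) (simp only: N E' map_pmf_comp case_prod_unfold count fst_conv snd_conv)
qed

lemma (in prob_space) cdf_edge_discrepancy: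
  assumes G: "graph V E" "[V]\<^bsup>2\<^esup> \<noteq> {}"
    and indep: "indep_vars (\<lambda>_. count_space UNIV) Y ([V]\<^bsup>2\<^esup>)"
    and a: "0 \<le> a" "a \<le> 1" and b: "0 \<le> b" "b \<le> 1"
    and law_N: "\<And>e. e \<in> non_edges V E \<Longrightarrow> has_bernoulli_law M (Y e) a"
    and law_E: "\<And>e. e \<in> E \<Longrightarrow> has_bernoulli_law M (Y e) (1 - b)"
  shows "cdf (distr M borel (edge_discrepancy V E Y)) x =
     measure_pmf.prob (pair_pmf (binomial_pmf (card (non_edges V E)) a) (binomial_pmf (card E) b))
       {(i, j). real_of_int (int i - int j) \<le> x}"
proof -
  let ?N = "non_edges V E"
  let ?P = "Pi_pmf (?N \<union> E) False (\<lambda>e. bernoulli_pmf (if e \<in> E then 1 - b else a))"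
  have NE: "?N \<union> E = [V]\<^bsup>2\<^esup>" "?N \<inter> E = {}" and fin: "finite ?N" "finite E"
    using G finite_imp_finite_nsets[of V 2] by (auto simp: graph_def non_edges_def intro: finite_subset)
  have fin_pairs: "finite ([V]\<^bsup>2\<^esup>)"
    using fin unfolding NE(1)[symmetric] by simp
  have law: "has_bernoulli_law M (Y e) (if e \<in> E then 1 - b else a)" if "e \<in> ?N \<union> E" for e
    using that law_N law_E by auto
  have p: "0 \<le> (if e \<in> E then 1 - b else a) \<and> (if e \<in> E then 1 - b else a) \<le> 1" for e
    using a b by auto
  note success = success_set_law[where A = "?N \<union> E" and Y = Y and p = "\<lambda>e. if e \<in> E then 1 - b else a"
      and Q = "\<lambda>S. real (card S) - real (card E) \<le> t" for t]
  have D: "edge_discrepancy V E Y \<omega> = real (card {e \<in> ?N \<union> E. Y e \<omega> = 1}) - real (card E)" for \<omega>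
    by (simp add: edge_discrepancy_def observed_edges_def NE)
  have "{\<omega> \<in> space M. edge_discrepancy V E Y \<omega> \<le> t} \<in> events" for t
    unfolding D using fin_pairs G indep by (intro success(1) law p) (auto simp: NE)
  then have "edge_discrepancy V E Y \<in> borel_measurable M"
    by (simp add: borel_measurable_iff_le)
  then have "cdf (distr M borel (edge_discrepancy V E Y)) x = prob {\<omega> \<in> space M. edge_discrepancy V E Y \<omega> \<le> x}"
    unfolding cdf_def by (subst measure_distr) (auto intro!: arg_cong[where f = prob])
  also have "\<dots> = measure_pmf.prob ?P {f. real (card {e \<in> ?N \<union> E. f e}) - real (card E) \<le> x}"
    unfolding D using fin_pairs G indep by (intro success(2) law p) (auto simp: NE)
  also have "\<dots> = measure_pmf.prob (map_pmf (\<lambda>f. int (card {e \<in> ?N \<union> E. f e}) - int (card E)) ?P)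
      {z. real_of_int z \<le> x}"
    by (simp add: vimage_def)
  also have "\<dots> = measure_pmf.prob (pair_pmf (binomial_pmf (card ?N) a) (binomial_pmf (card E) b))
      {(i, j). real_of_int (int i - int j) \<le> x}"
    unfolding success_count_minus_card_law[OF fin(2,1) NE(2) a b]
    by (auto intro!: arg_cong2[where f = measure_pmf.prob])
  finally show ?thesis .
qed

section \<open>The Kolmogorov--Smirnov bound\<close>

lemma cdf_skellam:
  "cdf (skellam a b) x =
     measure_pmf.prob (pair_pmf (poisson_pmf a) (poisson_pmf b)) {(i, j). real_of_int (int i - int j) \<le> x}"
  unfolding cdf_def skellam_def skellam_pmf_def
  by (subst measure_distr) (auto intro!: arg_cong2[where f = measure_pmf.prob])

lemma ks_dist_leI:
  assumes "\<And>x. \<bar>cdf P x - cdf Q x\<bar> \<le> c"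
  shows "ks_dist P Q \<le> c"
  unfolding ks_dist_def using assms by (intro cSUP_least) auto

text \<open>
  The uniform bound enters because the supremum of an unbounded set of reals is unspecified.
\<close>

lemma ks_dist_nonneg:
  assumes "\<And>x. \<bar>cdf P x - cdf Q x\<bar> \<le> c"
  shows "0 \<le> ks_dist P Q"
proof -
  have "\<bar>cdf P 0 - cdf Q 0\<bar> \<le> ks_dist P Q"
    unfolding ks_dist_def using assms by (intro cSUP_upper bdd_aboveI2) auto
  then show ?thesis by linarith
qed

text \<open>
  The bound for a single graph. It turns the asymptotic claim into the task of showing that both
  error probabilities are of order \<open>1/|V|\<close>.
\<close>

lemma (in prob_space) ks_dist_edge_discrepancy_skellam:
  assumes G: "graph V E"
    and indep: "indep_vars (\<lambda>_. count_space UNIV) Y ([V]\<^bsup>2\<^esup>)"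
    and a: "0 < a" "a < 1" and b: "0 < b" "b < 1"
    and law_N: "\<And>e. e \<in> non_edges V E \<Longrightarrow> has_bernoulli_law M (Y e) a"
    and law_E: "\<And>e. e \<in> E \<Longrightarrow> has_bernoulli_law M (Y e) (1 - b)"
    and ne: "card (non_edges V E) > 0" "card E > 0"
    and l: "l = a * real (card (non_edges V E))" "l' = b * real (card E)"
  shows "\<bar>ks_dist (distr M borel (edge_discrepancy V E Y)) (skellam l l')\<bar> \<le> a + b"
proof -
  have "[V]\<^bsup>2\<^esup> \<noteq> {}" using ne(1) by (auto simp: non_edges_def)
  then have cdf_D: "cdf (distr M borel (edge_discrepancy V E Y)) x =
      measure_pmf.prob (pair_pmf (binomial_pmf (card (non_edges V E)) a) (binomial_pmf (card E) b))
        {(i, j). real_of_int (int i - int j) \<le> x}" for x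
    using a b by (intro cdf_edge_discrepancy[OF G _ indep _ _ _ _ law_N law_E]) auto
  have "\<bar>cdf (distr M borel (edge_discrepancy V E Y)) x - cdf (skellam l l') x\<bar> \<le> a + b" for x
    unfolding cdf_skellam cdf_D l mult.commute[of a] mult.commute[of b]
    using a b ne by (intro difference_cdf_distance binomial_poisson_cdf_distance)
  then show ?thesis
    using ks_dist_leI ks_dist_nonneg by (metis abs_of_nonneg)
qed

theorem theorem6:
  fixes V :: "nat \<Rightarrow> 'v set"
    and E :: "nat \<Rightarrow> 'v set set"
    and M :: "nat \<Rightarrow> 'w measure"
    and Y :: "nat \<Rightarrow> 'v set \<Rightarrow> 'w \<Rightarrow> nat"
    and \<alpha> \<beta> lam :: "nat \<Rightarrow> real"
  assumes graph: "\<And>k. graph (V k) (E k)"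
    and size: "filterlim (\<lambda>k. card (V k)) at_top sequentially"
    and density: "sparse_graphs V E \<or> dense_graphs V E"
    and prob: "\<And>k. prob_space (M k)"
    and indep: "\<And>k. prob_space.indep_vars (M k) (\<lambda>_. count_space UNIV) (Y k) ([V k]\<^bsup>2\<^esup>)"
    and alpha: "\<And>k. 0 < \<alpha> k \<and> \<alpha> k < 1"
    and beta: "\<And>k. 0 < \<beta> k \<and> \<beta> k < 1"
    and law_non_edge:
      "\<And>k e. e \<in> non_edges (V k) (E k) \<Longrightarrow> has_bernoulli_law (M k) (Y k e) (\<alpha> k)"
    and law_edge:
      "\<And>k e. e \<in> E k \<Longrightarrow> has_bernoulli_law (M k) (Y k e) (1 - \<beta> k)"
    and lam_alpha: "\<And>k. lam k = \<alpha> k * real (card (non_edges (V k) (E k)))"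
    and lam_beta: "\<And>k. lam k = \<beta> k * real (card (E k))"
    and lam_order: "lam \<in> \<Theta>(\<lambda>k. avg_degree (V k) (E k))"
  shows "(\<lambda>k. ks_dist (distr (M k) borel (edge_discrepancy (V k) (E k) (Y k)))
                       (skellam (lam k) (lam k)))
         \<in> O(\<lambda>k. 1 / real (card (V k)))"
proof -
  let ?n = "\<lambda>k. real (card (V k))" and ?e = "\<lambda>k. real (card (E k))"
    and ?N = "\<lambda>k. real (card (non_edges (V k) (E k)))"
  have large: "\<forall>\<^sub>F k in sequentially. card (V k) \<ge> 2"
    using size by (simp add: filterlim_at_top)
  have "?N \<in> \<Omega>(\<lambda>k. ?n k ^ 2)"
    using density by (auto simp: sparse_graphs_def dense_graphs_def intro: bigthetaD2)
  then obtain d where d: "d > 0" "\<forall>\<^sub>F k in sequentially. ?N k \<ge> d * ?n k ^ 2"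
    by (elim landau_omega.bigE) auto
  have "lam \<in> O(\<lambda>k. avg_degree (V k) (E k))"
    using lam_order by (rule bigthetaD1)
  then obtain c where c: "c > 0" "\<forall>\<^sub>F k in sequentially. \<bar>lam k\<bar> \<le> c * \<bar>avg_degree (V k) (E k)\<bar>"
    by (elim landau_o.bigE) auto
  \<comment> \<open>Binomial laws with no trials would have mean 0, where the Poisson law is unspecified.\<close>
  have edges: "\<forall>\<^sub>F k in sequentially. card (E k) > 0"
  proof -
    define g where "g = (\<lambda>n::nat. if sparse_graphs V E then real n * ln (real n) else real n ^ 2)"
    have "?e \<in> \<Omega>(\<lambda>k. g (card (V k)))"
    proof (cases "sparse_graphs V E")
      case True
      then show ?thesis
        unfolding g_def by (auto simp: sparse_graphs_def intro: bigthetaD2)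
    next
      case False
      then show ?thesis
        using density unfolding g_def by (auto simp: dense_graphs_def intro: bigthetaD2)
    qed
    then obtain c' where c': "c' > 0" "\<forall>\<^sub>F k in sequentially. ?e k \<ge> c' * \<bar>g (card (V k))\<bar>"
      by (elim landau_omega.bigE) auto
    have g_pos: "g n > 0" if "n \<ge> 2" for n
      using that by (auto simp: g_def)
    show ?thesis
      using large c'(2)
    proof eventually_elim
      case (elim k)
      have "0 < c' * \<bar>g (card (V k))\<bar>" using c'(1) g_pos[OF elim(1)] by simp
      with elim(2) have "0 < ?e k" by linarith
      then show ?case by simp
    qed
  qed
  have bound: "\<forall>\<^sub>F k in sequentially.
      norm (ks_dist (distr (M k) borel (edge_discrepancy (V k) (E k) (Y k))) (skellam (lam k) (lam k)))
        \<le> (1 / d + 1) * (2 * c) * norm (1 / ?n k)"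
    using large d(2) c(2) edges
  proof eventually_elim
    case (elim k)
    then have n: "?n k > 0" and e: "?e k > 0" by auto
    have "0 < d * ?n k ^ 2" using n d(1) by simp
    then have N: "?N k > 0" using elim(2) by linarith
    have "card (E k) \<le> card (V k) choose 2"
      using graph[of k] card_mono[of "[V k]\<^bsup>2\<^esup>" "E k"] finite_imp_finite_nsets[of "V k" 2]
      by (simp add: graph_def card_nsets)
    also have "\<dots> \<le> card (V k) ^ 2" using elim(1) by (rule binomial_le_pow)
    finally have e_le: "?e k \<le> ?n k ^ 2" by (metis of_nat_le_iff of_nat_power)
    have "\<beta> k * ?e k \<le> c * (2 * ?e k / ?n k)"
      using elim(3) lam_beta[of k] beta[of k] by (simp add: avg_degree_def)
    then have beta_le: "\<beta> k \<le> 2 * c * (1 / ?n k)"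
      using n e by (simp add: field_simps)
    have "\<alpha> k * (d * ?n k ^ 2) \<le> \<alpha> k * ?N k"
      using elim(2) alpha[of k] by (intro mult_left_mono) auto
    also have "\<dots> = \<beta> k * ?e k"
      using lam_alpha[of k] lam_beta[of k] by simp
    also have "\<dots> \<le> \<beta> k * ?n k ^ 2"
      using e_le beta[of k] by (intro mult_left_mono) auto
    finally have alpha_le: "\<alpha> k \<le> 1 / d * \<beta> k"
      using n d(1) by (simp add: field_simps)
    interpret prob_space "M k" by (rule prob)
    have "norm (ks_dist (distr (M k) borel (edge_discrepancy (V k) (E k) (Y k))) (skellam (lam k) (lam k)))
        \<le> \<alpha> k + \<beta> k"
      unfolding real_norm_def
      using alpha beta e N lam_alpha lam_beta
      by (intro ks_dist_edge_discrepancy_skellam graph indep law_non_edge law_edge) auto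
    also have "\<dots> \<le> (1 / d + 1) * \<beta> k"
      using alpha_le by (simp add: algebra_simps)
    also have "\<dots> \<le> (1 / d + 1) * (2 * c * (1 / ?n k))"
      using beta_le d(1) by (intro mult_left_mono) auto
    finally show ?case using n by simp
  qed
  then show ?thesis by (rule bigoI)
qed

end
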